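(* Let $n_1,n_2,n,l$ be positive integers and let $\Theta=(\pi_1,\pi_2,\pi)\in S_{n_1}\times S_{n_2}\times S_n$ be an extendable isotopism with cycle structure $z_{\Theta}=(l,l,1^l)$ (so that $\pi_1$ and $\pi_2$ each consist of a single cycle of length $l$ and $\pi$ is the identity on $l$ symbols; in particular $n_1=n_2=n=l$). Then $\chi_g^{\Theta}(\mathcal{H}_{n_1,n_2})=l$.
   Context: $[m]=\{1,\ldots,m\}$; elements of $\mathfrak{I}_{n_1,\ldots,n_d,n}=S_{n_1}\times\cdots\times S_{n_d}\times S_n$ are called isotopisms (here $d=2$). For a permutation $\pi$, $l_{\pi,s}$ is the length of the cycle containing $s$ and $\lambda^{\pi}_{l}$ the number of cycles of length $l$. The cycle structure of $\pi\in S_m$ is the formal expression $z_\pi=m^{\lambda^\pi_m}\cdots1^{\lambda^\pi_1}$ (terms with zero exponent omitted, $l^1$ written $l$), and $z_\Theta=(z_{\pi_1},\ldots,z_{\pi_d},z_\pi)$. A $k$-tuple of positive integers is in $\mathcal{C}_k$ (lcm-compatible) if the lcm of any $k-1$ of its entries equals the lcm of all entries. $\Theta=(\pi_1,\ldots,\pi_d,\pi)$ is feasible if $(l_1,\ldots,l_d,\ell)\in\mathcal{C}_{d+1}$ for every $(l_1,\ldots,l_d,\ell)\in[n_1]\times\cdots\times[n_d]\times[n]$ with $\lambda^{\pi}_{\ell}\prod_j\lambda^{\pi_j}_{l_j}>0$. The natural extension of $\Theta$ of size $n'\ge n$ is $\Theta'=(\pi_1,\ldots,\pi_d,\pi')\in\mathfrak{I}_{n_1,\ldots,n_d,n'}$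 with $\pi'(s)=\pi(s)$ for $s\le n$, $\pi'(s)=s$ for $n<s\le n'$. $\Theta$ is extendable if all its natural extensions are feasible. The Hamming graph $\mathcal{H}_{n_1,\ldots,n_d}$ has vertices (cells) $[n_1]\times\cdots\times[n_d]$, two being adjacent (collinear) iff they differ in exactly one coordinate. A partial colouring $P$ of the cells by $[n']$ is $\Theta'$-compatible if for every non-empty cell $(i_1,\ldots,i_d)$: $(l_{\pi_1,i_1},\ldots,l_{\pi_d,i_d},l_{\pi',P(i_1,\ldots,i_d)})\in\mathcal{C}_{d+1}$, and for every positive integer $m$ the cell $(\pi_1^m(i_1),\ldots,\pi_d^m(i_d))$ is either empty or contains $(\pi')^m(P(i_1,\ldots,i_d))$. $\Theta$-stabilized colouring game with $n'$ colours: starting from the empty board, Alice and Bob alternately choose an empty cell $(i_1,\ldots,i_d)$ and colour it with a symbol $s\in[n']$ such that: (Rule 1) adjacent coloured cells have different colours afterwards; (Rule 2) the resulting partial colouring is $\Theta'$-compatible; (Rule 3) for each positive integer $m<\mathrm{lcm}(l_{\pi_1,i_1},\ldots,l_{\pi_d,i_d})$ and each coloured cell $(i_1',\ldots,i_d')$ collinear with $(\pi_1^m(i_1),\ldots,\pi_d^m(i_d))$, $P(i_1',\ldots,i_d')\ne(\pi')^m(s)$. Alice wins if all cells are coloured at the end; otherwise Bob wins. $\chi_g^\Theta(\mathcal{H}_{n_1,\ldots,n_d})$ is the smallest size $n'\geq n$ of a natural extension of $\Theta$ for which Alice has a winning strategy; there are two variants $g_A$, $g_B$ according to whether Alice or Bob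 moves first, and the unsubscripted statement refers to either variant. *)

theory Defs
  imports
    "HOL-Combinatorics.Permutations"
    "HOL-Combinatorics.Orbits"
    "HOL-Library.Multiset"
    "HOL-Library.Extended_Nat"
begin

text \<open>The symmetric group on \<open>[m] = {1..m}\<close> is rendered by \<^const>\<open>permutes\<close>, so elements of
  \<open>S\<^sub>m\<close> are functions on \<^typ>\<open>nat\<close> that are the identity outside \<open>{1..m}\<close>.\<close>

type_synonym isotopism = "(nat \<Rightarrow> nat) \<times> (nat \<Rightarrow> nat) \<times> (nat \<Rightarrow> nat)"

definition isotopisms :: "nat \<Rightarrow> nat \<Rightarrow> nat \<Rightarrow> isotopism set" where
  "isotopisms n1 n2 n =
     {(\<pi>1, \<pi>2, \<pi>). \<pi>1 permutes {1..n1} \<and> \<pi>2 permutes {1..n2} \<and> \<pi> permutes {1..n}}"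


section \<open>Cycle structure\<close>

definition cycle_length :: "(nat \<Rightarrow> nat) \<Rightarrow> nat \<Rightarrow> nat" where
  "cycle_length \<pi> s = card (orbit \<pi> s)"

definition num_cycles :: "nat \<Rightarrow> (nat \<Rightarrow> nat) \<Rightarrow> nat \<Rightarrow> nat" where
  "num_cycles m \<pi> l = card {C \<in> orbit \<pi> ` {1..m}. card C = l}"

text \<open>The formal expression \<open>m\<^bsup>\<lambda>(m)\<^esup> \<dots> 1\<^bsup>\<lambda>(1)\<^esup>\<close> is the multiset containing each
  length \<open>l\<close> exactly \<open>\<lambda>(l)\<close> times.\<close>

definition cycle_structure :: "nat \<Rightarrow> (nat \<Rightarrow> nat) \<Rightarrow> nat multiset" where
  "cycle_structure m \<pi> = (\<Sum>l\<in>{1..m}. replicate_mset (num_cycles m \<pi> l) l)"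

definition isotopism_cycle_structure ::
    "nat \<Rightarrow> nat \<Rightarrow> nat \<Rightarrow> isotopism \<Rightarrow> nat multiset \<times> nat multiset \<times> nat multiset" where
  "isotopism_cycle_structure n1 n2 n = (\<lambda>(\<pi>1, \<pi>2, \<pi>).
     (cycle_structure n1 \<pi>1, cycle_structure n2 \<pi>2, cycle_structure n \<pi>))"


section \<open>Feasible and extendable isotopisms\<close>

text \<open>Membership of the tuple \<open>xs\<close> in \<open>C\<^sub>k\<close>, with \<open>k = length xs\<close>.\<close>

definition lcm_compatible :: "nat list \<Rightarrow> bool" where
  "lcm_compatible xs \<longleftrightarrow>
     (\<forall>x\<in>set xs. x > 0) \<and>
     (\<forall>i<length xs. Lcm (set (take i xs @ drop (Suc i) xs)) = Lcm (set xs))"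

definition feasible :: "nat \<Rightarrow> nat \<Rightarrow> nat \<Rightarrow> isotopism \<Rightarrow> bool" where
  "feasible n1 n2 n = (\<lambda>(\<pi>1, \<pi>2, \<pi>).
     \<forall>l1\<in>{1..n1}. \<forall>l2\<in>{1..n2}. \<forall>l\<in>{1..n}.
       num_cycles n \<pi> l * (num_cycles n1 \<pi>1 l1 * num_cycles n2 \<pi>2 l2) > 0 \<longrightarrow>
       lcm_compatible [l1, l2, l])"

text \<open>As a function, the natural extension does not depend on its size \<open>n'\<close>, because
  permutations of \<open>{1..n'}\<close> are the identity outside \<open>{1..n'}\<close> anyway; the size is passed
  separately wherever it matters.\<close>

definition natural_extension :: "nat \<Rightarrow> isotopism \<Rightarrow> isotopism" where
  "natural_extension n = (\<lambda>(\<pi>1, \<pi>2, \<pi>). (\<pi>1, \<pi>2, \<lambda>s. if s \<le> n then \<pi> s else s))"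

definition extendable :: "nat \<Rightarrow> nat \<Rightarrow> nat \<Rightarrow> isotopism \<Rightarrow> bool" where
  "extendable n1 n2 n \<Theta> \<longleftrightarrow> (\<forall>n'\<ge>n. feasible n1 n2 n' (natural_extension n \<Theta>))"


section \<open>Partial colourings of the Hamming graph\<close>

type_synonym cell = "nat \<times> nat"
type_synonym colouring = "cell \<Rightarrow> nat option"

definition cells :: "nat \<Rightarrow> nat \<Rightarrow> cell set" where
  "cells n1 n2 = {1..n1} \<times> {1..n2}"

definition collinear :: "cell \<Rightarrow> cell \<Rightarrow> bool" where
  "collinear = (\<lambda>(i, j) (i', j'). (i \<noteq> i' \<and> j = j') \<or> (i = i' \<and> j \<noteq> j'))"

definition proper_colouring :: "nat \<Rightarrow> nat \<Rightarrow> colouring \<Rightarrow> bool" where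
  "proper_colouring n1 n2 P \<longleftrightarrow>
     (\<forall>c\<in>cells n1 n2. \<forall>c'\<in>cells n1 n2.
        collinear c c' \<and> P c \<noteq> None \<and> P c' \<noteq> None \<longrightarrow> P c \<noteq> P c')"

definition compatible :: "nat \<Rightarrow> nat \<Rightarrow> isotopism \<Rightarrow> colouring \<Rightarrow> bool" where
  "compatible n1 n2 = (\<lambda>(\<pi>1, \<pi>2, \<pi>) P.
     \<forall>i\<in>{1..n1}. \<forall>j\<in>{1..n2}. \<forall>s. P (i, j) = Some s \<longrightarrow>
       lcm_compatible [cycle_length \<pi>1 i, cycle_length \<pi>2 j, cycle_length \<pi> s] \<and>
       (\<forall>m>0. P ((\<pi>1 ^^ m) i, (\<pi>2 ^^ m) j) \<in> {None, Some ((\<pi> ^^ m) s)}))"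


section \<open>The stabilized colouring game\<close>

text \<open>Below, \<open>\<Theta>\<close> is already the natural extension and \<open>n'\<close> its size. The third rule of
  the game is evaluated on the colouring after the move. Together with the second rule,
  \<open>compatible\<close>, this is the same as evaluating it before the move: if the new cell is
  collinear with its own image under the \<open>m\<close>-th power, lcm-compatibility already forces
  the \<open>m\<close>-th power to move \<open>s\<close>.\<close>

definition rule3 :: "nat \<Rightarrow> nat \<Rightarrow> isotopism \<Rightarrow> colouring \<Rightarrow> cell \<Rightarrow> nat \<Rightarrow> bool" where
  "rule3 n1 n2 = (\<lambda>(\<pi>1, \<pi>2, \<pi>) P (i, j) s.
     \<forall>m. 0 < m \<and> m < lcm (cycle_length \<pi>1 i) (cycle_length \<pi>2 j) \<longrightarrow>
       (\<forall>c'\<in>cells n1 n2. P c' \<noteq> None \<and> collinear c' ((\<pi>1 ^^ m) i, (\<pi>2 ^^ m) j) \<longrightarrow>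
          P c' \<noteq> Some ((\<pi> ^^ m) s)))"

type_synonym move = "cell \<times> nat"

definition legal_move :: "nat \<Rightarrow> nat \<Rightarrow> nat \<Rightarrow> isotopism \<Rightarrow> colouring \<Rightarrow> move \<Rightarrow> bool" where
  "legal_move n1 n2 n' \<Theta> P = (\<lambda>(c, s).
     c \<in> cells n1 n2 \<and> P c = None \<and> s \<in> {1..n'} \<and>
     proper_colouring n1 n2 (P(c \<mapsto> s)) \<and>
     compatible n1 n2 \<Theta> (P(c \<mapsto> s)) \<and>
     rule3 n1 n2 \<Theta> (P(c \<mapsto> s)) c s)"

text \<open>A play is the list of moves made so far, in chronological order.\<close>

definition board :: "move list \<Rightarrow> colouring" where
  "board ms = foldl (\<lambda>P (c, s). P(c \<mapsto> s)) Map.empty ms"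

definition legal_play :: "nat \<Rightarrow> nat \<Rightarrow> nat \<Rightarrow> isotopism \<Rightarrow> move list \<Rightarrow> bool" where
  "legal_play n1 n2 n' \<Theta> ms \<longleftrightarrow>
     (\<forall>k<length ms. legal_move n1 n2 n' \<Theta> (board (take k ms)) (ms ! k))"

definition finished :: "nat \<Rightarrow> nat \<Rightarrow> nat \<Rightarrow> isotopism \<Rightarrow> move list \<Rightarrow> bool" where
  "finished n1 n2 n' \<Theta> ms \<longleftrightarrow> (\<nexists>mv. legal_move n1 n2 n' \<Theta> (board ms) mv)"

datatype player = Alice | Bob

text \<open>Whether Alice makes the move following \<open>k\<close> moves, given who moves first.\<close>

definition alice_to_move :: "player \<Rightarrow> nat \<Rightarrow> bool" where
  "alice_to_move first k \<longleftrightarrow> (even k \<longleftrightarrow> first = Alice)"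

definition follows :: "player \<Rightarrow> (move list \<Rightarrow> move) \<Rightarrow> move list \<Rightarrow> bool" where
  "follows first \<sigma> ms \<longleftrightarrow>
     (\<forall>k<length ms. alice_to_move first k \<longrightarrow> ms ! k = \<sigma> (take k ms))"

text \<open>The first conjunct says that the strategy prescribes a legal move whenever Alice has to
  move and the game is not over; without it, a strategy prescribing illegal moves would
  win vacuously.\<close>

definition alice_winning_strategy ::
    "player \<Rightarrow> nat \<Rightarrow> nat \<Rightarrow> nat \<Rightarrow> isotopism \<Rightarrow> (move list \<Rightarrow> move) \<Rightarrow> bool" where
  "alice_winning_strategy first n1 n2 n' \<Theta> \<sigma> \<longleftrightarrow>
     (\<forall>ms. legal_play n1 n2 n' \<Theta> ms \<and> follows first \<sigma> ms \<longrightarrow>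
        (\<not> finished n1 n2 n' \<Theta> ms \<and> alice_to_move first (length ms) \<longrightarrow>
           legal_move n1 n2 n' \<Theta> (board ms) (\<sigma> ms)) \<and>
        (finished n1 n2 n' \<Theta> ms \<longrightarrow> (\<forall>c\<in>cells n1 n2. board ms c \<noteq> None)))"

text \<open>The value is \<open>\<infinity>\<close> if Alice wins with no number of colours. The first argument
  selects the variant: \<^const>\<open>Alice\<close> gives \<open>g\<^sub>A\<close> and \<^const>\<open>Bob\<close> gives \<open>g\<^sub>B\<close>.\<close>

definition stabilized_game_chromatic_number ::
    "player \<Rightarrow> nat \<Rightarrow> nat \<Rightarrow> nat \<Rightarrow> isotopism \<Rightarrow> enat" where
  "stabilized_game_chromatic_number first n1 n2 n \<Theta> =
     Inf {enat n' | n'. n' \<ge> n \<and>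
       (\<exists>\<sigma>. alice_winning_strategy first n1 n2 n' (natural_extension n \<Theta>) \<sigma>)}"

end

theory Submission
  imports Defs
begin

text \<open>
  Two full cycles \<open>p\<close> and \<open>q\<close> of length \<open>l\<close> act diagonally on the \<open>l \<times> l\<close> board, and
  its \<open>l\<^sup>2\<close> cells split into \<open>l\<close> orbits of size \<open>l\<close>, here called diagonals. A power of
  \<open>p\<close> fixing a row has exponent divisible by \<open>l\<close>, hence the same power of \<open>q\<close> fixes every
  column, and vice versa: no row or column contains two cells of a diagonal, so each contains
  exactly one of its \<open>l\<close> cells.

  The triple \<open>(l, l, 1)\<close> is lcm-compatible, so cycle lengths restrict no move. As the symbols
  are fixed, compatibility forces one colour along a diagonal. Conversely,
  any cell off a given diagonal is collinear with one of its cells, so properness and the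
  third rule together forbid repeating a colour on another diagonal. The rules thus reduce to
  one condition (\<open>legal_move_iff\<close>): two coloured cells have equal colours iff they lie on
  the same diagonal.

  Under this condition the game cannot get stuck (\<open>diagonal_colouring_extend\<close>). An empty
  cell on a diagonal that already has a colour takes that colour; on an uncoloured diagonal at
  most \<open>l - 1\<close> colours have been used elsewhere, so with at least \<open>l\<close> colours a fresh one
  remains. Every play therefore ends with a full board, and Alice wins however she plays. Since
  natural extensions have size at least \<open>n = l\<close>, the chromatic number is \<open>l\<close>.
\<close>

section \<open>Powers of a full cycle\<close>

lemma cyclic_on_funpow_eq_self_iff:
  assumes "cyclic_on f S" "s \<in> S"
  shows "(f ^^ m) s = s \<longleftrightarrow> card S dvd m"
proof -
  define d where "d = funpow_dist1 f s s"
  have S: "orbit f s = S" using assms by (rule orbit_cyclic_eq3)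
  then have self: "s \<in> orbit f s" using assms(2) by simp
  have "card (orbit f s) = d"
    using orbit_conv_funpow_dist1[OF self] inj_on_funpow_dist1[OF self]
    by (simp add: card_image d_def)
  then have d: "card S = d" by (simp add: S)
  have period: "(f ^^ d) s = s" unfolding d_def by (rule funpow_dist1_prop[OF self])
  have "(f ^^ m) s = (f ^^ (m mod d)) s" by (rule funpow_mod_eq[OF period, symmetric])
  moreover have "(f ^^ (m mod d)) s = s \<longleftrightarrow> m mod d = 0"
  proof (cases "m mod d = 0")
    case False
    moreover have "m mod d < funpow_dist1 f s s" by (simp add: d_def)
    ultimately show ?thesis using funpow_dist1_least[of "m mod d" f s s] by blast
  qed simp
  ultimately show ?thesis by (simp add: d dvd_eq_mod_eq_0)
qed

lemma cyclic_on_reach: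
  assumes "cyclic_on f S" "s \<in> S" "t \<in> S"
  obtains m where "m < card S" "(f ^^ m) s = t"
proof -
  have pos: "0 < card S"
    using assms(2) finite_cyclic_on[OF assms(1)] by (auto simp: card_gt_0_iff)
  have period: "(f ^^ card S) s = s"
    by (simp only: cyclic_on_funpow_eq_self_iff[OF assms(1,2)] dvd_refl)
  have "t \<in> orbit f s" using orbit_cyclic_eq3[OF assms(1,2)] assms(3) by simp
  then obtain m where "t = (f ^^ m) s" "m < card S"
    unfolding orbit_altdef_bounded[OF period pos] by (elim CollectE exE conjE)
  then show thesis using that[of m] by simp
qed

section \<open>Diagonals of the board\<close>

locale two_full_cycles =
  fixes p q :: "nat \<Rightarrow> nat" and l :: nat
  assumes cyclic_p: "cyclic_on p {1..l}" and cyclic_q: "cyclic_on q {1..l}"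
begin

definition same_diagonal :: "cell \<Rightarrow> cell \<Rightarrow> bool" where
  "same_diagonal c c' \<longleftrightarrow> (\<exists>m. c' = ((p ^^ m) (fst c), (q ^^ m) (snd c)))"

definition diagonal_colouring :: "colouring \<Rightarrow> bool" where
  "diagonal_colouring P \<longleftrightarrow> (\<forall>c\<in>cells l l. \<forall>c'\<in>cells l l.
     P c \<noteq> None \<and> P c' \<noteq> None \<longrightarrow> (P c = P c' \<longleftrightarrow> same_diagonal c c'))"

lemma l_pos: "l > 0"
  using cyclic_p by (cases l) (auto simp: cyclic_on_alldef)

lemma funpow_p_in: "i \<in> {1..l} \<Longrightarrow> (p ^^ m) i \<in> {1..l}"
  by (rule cyclic_on_funpow_in[OF cyclic_p])

lemma funpow_q_in: "j \<in> {1..l} \<Longrightarrow> (q ^^ m) j \<in> {1..l}"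
  by (rule cyclic_on_funpow_in[OF cyclic_q])

lemma funpow_p_eq_self_iff: "i \<in> {1..l} \<Longrightarrow> (p ^^ m) i = i \<longleftrightarrow> l dvd m"
  using cyclic_on_funpow_eq_self_iff[OF cyclic_p] by simp

lemma funpow_q_eq_self_iff: "j \<in> {1..l} \<Longrightarrow> (q ^^ m) j = j \<longleftrightarrow> l dvd m"
  using cyclic_on_funpow_eq_self_iff[OF cyclic_q] by simp

lemma cycle_lengths:
  "i \<in> {1..l} \<Longrightarrow> cycle_length p i = l" "j \<in> {1..l} \<Longrightarrow> cycle_length q j = l"
  using orbit_cyclic_eq3[OF cyclic_p] orbit_cyclic_eq3[OF cyclic_q]
  by (simp_all add: cycle_length_def)

lemma same_diagonal_refl: "same_diagonal c c"
  unfolding same_diagonal_def by (rule exI[of _ 0]) simp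

lemma same_diagonal_trans:
  assumes "same_diagonal c d" "same_diagonal d e"
  shows "same_diagonal c e"
proof -
  obtain m k where "d = ((p ^^ m) (fst c), (q ^^ m) (snd c))" "e = ((p ^^ k) (fst d), (q ^^ k) (snd d))"
    using assms by (auto simp: same_diagonal_def)
  then have "e = ((p ^^ (k + m)) (fst c), (q ^^ (k + m)) (snd c))" by (simp add: funpow_add)
  then show ?thesis unfolding same_diagonal_def by blast
qed

lemma same_diagonal_sym:
  assumes "c \<in> cells l l" "same_diagonal c d"
  shows "same_diagonal d c"
proof -
  obtain m where m: "d = ((p ^^ m) (fst c), (q ^^ m) (snd c))"
    using assms(2) by (auto simp: same_diagonal_def)
  \<comment> \<open>The inverse of the \<open>m\<close>-th power is its \<open>(l - 1)\<close>-th power.\<close>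
  define k where "k = (l - 1) * m"
  have "k + m = l * m" using l_pos by (cases l) (simp_all add: k_def)
  then have "l dvd k + m" by simp
  then have "(p ^^ (k + m)) (fst c) = fst c" "(q ^^ (k + m)) (snd c) = snd c"
    using assms(1) funpow_p_eq_self_iff funpow_q_eq_self_iff by (auto simp: cells_def)
  then have "c = ((p ^^ k) (fst d), (q ^^ k) (snd d))"
    using m by (simp add: funpow_add prod_eq_iff)
  then show ?thesis unfolding same_diagonal_def by blast
qed

lemma same_diagonal_not_collinear:
  assumes "c \<in> cells l l" "same_diagonal c d"
  shows "\<not> collinear c d"
proof -
  obtain m where m: "d = ((p ^^ m) (fst c), (q ^^ m) (snd c))"
    using assms(2) by (auto simp: same_diagonal_def)
  have "(p ^^ m) (fst c) = fst c \<longleftrightarrow> (q ^^ m) (snd c) = snd c"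
    using assms(1) funpow_p_eq_self_iff funpow_q_eq_self_iff by (auto simp: cells_def)
  then show ?thesis by (cases c) (auto simp: m collinear_def)
qed

lemma diagonal_meets_row:
  assumes "c \<in> cells l l" "i \<in> {1..l}"
  obtains j where "j \<in> {1..l}" "same_diagonal c (i, j)"
proof -
  have c: "fst c \<in> {1..l}" "snd c \<in> {1..l}" using assms(1) by (auto simp: cells_def)
  obtain m where m: "(p ^^ m) (fst c) = i"
    by (rule cyclic_on_reach[OF cyclic_p c(1) assms(2)])
  have "same_diagonal c (i, (q ^^ m) (snd c))"
    unfolding same_diagonal_def by (rule exI[of _ m]) (simp add: m)
  with funpow_q_in[OF c(2)] show thesis by (rule that)
qed

lemma diagonal_colouring_upd_iff:
  assumes "diagonal_colouring P" "c \<in> cells l l" "P c = None"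
  shows "diagonal_colouring (P(c \<mapsto> s)) \<longleftrightarrow>
    (\<forall>d\<in>cells l l. P d \<noteq> None \<longrightarrow> (P d = Some s \<longleftrightarrow> same_diagonal c d))" (is "?L \<longleftrightarrow> ?R")
proof
  assume L: ?L
  show ?R
  proof (intro ballI impI)
    fix d assume d: "d \<in> cells l l" "P d \<noteq> None"
    then have "d \<noteq> c" using assms(3) by metis
    moreover have "(P(c \<mapsto> s)) c = (P(c \<mapsto> s)) d \<longleftrightarrow> same_diagonal c d"
      using bspec[OF bspec[OF L[unfolded diagonal_colouring_def] assms(2)] d(1)] d(2) by auto
    ultimately show "P d = Some s \<longleftrightarrow> same_diagonal c d" by (metis fun_upd_apply)
  qed
next
  assume R: ?R
  show ?L
    unfolding diagonal_colouring_def
  proof (intro ballI impI)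
    fix d e
    assume de: "d \<in> cells l l" "e \<in> cells l l" "(P(c \<mapsto> s)) d \<noteq> None \<and> (P(c \<mapsto> s)) e \<noteq> None"
    have old: "P d = P e \<longleftrightarrow> same_diagonal d e" if "P d \<noteq> None" "P e \<noteq> None"
      using assms(1) de(1,2) that unfolding diagonal_colouring_def by simp
    have new: "P x = Some s \<longleftrightarrow> same_diagonal c x" if "x \<in> cells l l" "P x \<noteq> None" for x
      using R that by blast
    show "(P(c \<mapsto> s)) d = (P(c \<mapsto> s)) e \<longleftrightarrow> same_diagonal d e"
    proof (cases "d = c"; cases "e = c")
      assume "d = c" "e = c"
      then show ?thesis by (simp add: same_diagonal_refl)
    next
      assume "d = c" "e \<noteq> c"
      then show ?thesis using new[of e] de(2,3) by (metis fun_upd_apply)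
    next
      assume "d \<noteq> c" "e = c"
      moreover have "same_diagonal c d \<longleftrightarrow> same_diagonal d c"
        using same_diagonal_sym assms(2) de(1) by blast
      ultimately show ?thesis using new[of d] de(1,3) by (metis fun_upd_apply)
    next
      assume "d \<noteq> c" "e \<noteq> c"
      then show ?thesis using old de(3) by simp
    qed
  qed
qed

section \<open>The rules of the game on diagonals\<close>

text \<open>For the forward direction, a coloured cell \<open>(a, b)\<close> off the diagonal of the new cell
  \<open>(i, j)\<close> shares row \<open>a\<close> with the cell of that diagonal reached by the power \<open>m\<close> taking
  \<open>i\<close> to \<open>a\<close>: it is excluded by properness if \<open>m = 0\<close>, and by the third rule otherwise.
  Conversely, the third rule never forbids a diagonal colouring because two cells
  of one diagonal are not collinear.\<close>

lemma legal_move_iff: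
  assumes diag: "diagonal_colouring P"
  shows "legal_move l l n' (p, q, id) P (c, s) \<longleftrightarrow>
    c \<in> cells l l \<and> P c = None \<and> s \<in> {1..n'} \<and> diagonal_colouring (P(c \<mapsto> s))"
    (is "?L \<longleftrightarrow> ?R")
proof
  assume L: ?L
  then have c: "c \<in> cells l l" "P c = None" "s \<in> {1..n'}" by (auto simp: legal_move_def)
  obtain i j where ij: "c = (i, j)" "i \<in> {1..l}" "j \<in> {1..l}"
    using c(1) by (auto simp: cells_def)
  have proper: "\<not> (collinear c d \<and> P d = Some s)" if "d \<in> cells l l" for d
  proof
    assume "collinear c d \<and> P d = Some s"
    moreover have "proper_colouring l l (P(c \<mapsto> s))" using L by (simp add: legal_move_def)
    ultimately show False
      using c(1,2) that unfolding proper_colouring_def by (metis fun_upd_apply option.discI)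
  qed
  have compat: "(P(c \<mapsto> s)) ((p ^^ m) i, (q ^^ m) j) \<in> {None, Some s}" if "m > 0" for m
  proof -
    have "compatible l l (p, q, id) (P(c \<mapsto> s))" using L by (simp add: legal_move_def)
    then show ?thesis using that ij unfolding compatible_def by simp
  qed
  have rule3: "P d \<noteq> Some s"
    if "0 < m" "m < l" "d \<in> cells l l" "collinear d ((p ^^ m) i, (q ^^ m) j)" for m d
  proof -
    have "rule3 l l (p, q, id) (P(c \<mapsto> s)) c s" using L by (simp add: legal_move_def)
    then have "(P(c \<mapsto> s)) d \<noteq> Some s"
      using that cycle_lengths ij unfolding rule3_def by force
    then show ?thesis using c(2) by (metis fun_upd_apply)
  qed
  have "P d = Some s \<longleftrightarrow> same_diagonal c d" if d: "d \<in> cells l l" "P d \<noteq> None" for d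
  proof
    assume "same_diagonal c d"
    then obtain m where m: "d = ((p ^^ m) i, (q ^^ m) j)" by (auto simp: same_diagonal_def ij)
    have "d \<noteq> c" using d c by auto
    then have "m > 0" using m ij by (cases m) auto
    then show "P d = Some s" using compat[of m] m d \<open>d \<noteq> c\<close> by auto
  next
    assume s: "P d = Some s"
    obtain a b where ab: "d = (a, b)" "a \<in> {1..l}" "b \<in> {1..l}"
      using d(1) by (auto simp: cells_def)
    obtain m where m: "m < card {1..l}" "(p ^^ m) i = a"
      by (rule cyclic_on_reach[OF cyclic_p ij(2) ab(2)])
    have "b = (q ^^ m) j"
    proof (rule ccontr)
      assume b: "b \<noteq> (q ^^ m) j"
      show False
      proof (cases "m = 0")
        case True
        then have "collinear c d" using b m by (simp add: collinear_def ij ab)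
        then show False using proper d s by blast
      next
        case False
        then have "collinear d ((p ^^ m) i, (q ^^ m) j)" using b m by (simp add: collinear_def ab)
        then show False using rule3[of m d] False m d s by simp
      qed
    qed
    then show "same_diagonal c d" unfolding same_diagonal_def using m ab ij by auto
  qed
  then show ?R using c by (simp add: diagonal_colouring_upd_iff[OF diag c(1,2)])
next
  assume R: ?R
  define Q where "Q = P(c \<mapsto> s)"
  have c: "c \<in> cells l l" "P c = None" "s \<in> {1..n'}" and Q: "diagonal_colouring Q" "Q c = Some s"
    using R by (simp_all add: Q_def)
  obtain i j where ij: "c = (i, j)" "i \<in> {1..l}" "j \<in> {1..l}"
    using c(1) by (auto simp: cells_def)
  have eq_iff: "Q d = Q e \<longleftrightarrow> same_diagonal d e"
    if "d \<in> cells l l" "e \<in> cells l l" "Q d \<noteq> None" "Q e \<noteq> None" for d e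
    using Q that unfolding diagonal_colouring_def by blast
  have "proper_colouring l l Q"
    unfolding proper_colouring_def using eq_iff same_diagonal_not_collinear by blast
  moreover have "compatible l l (p, q, id) Q"
    unfolding compatible_def prod.case
  proof (intro ballI allI impI conjI)
    fix a b t assume ab: "a \<in> {1..l}" "b \<in> {1..l}" and t: "Q (a, b) = Some t"
    have "cycle_length id t = 1"
      by (simp add: cycle_length_def orbit_eq_singleton_iff[of id t, THEN iffD2])
    then show "lcm_compatible [cycle_length p a, cycle_length q b, cycle_length id t]"
      using cycle_lengths ab l_pos
      by (simp add: lcm_compatible_def less_Suc_eq all_conj_distrib numeral_eq_Suc)
    fix m :: nat
    have "same_diagonal (a, b) ((p ^^ m) a, (q ^^ m) b)" by (auto simp: same_diagonal_def)
    moreover have "((p ^^ m) a, (q ^^ m) b) \<in> cells l l"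
      using ab funpow_p_in funpow_q_in by (simp add: cells_def)
    moreover have "(a, b) \<in> cells l l" using ab by (simp add: cells_def)
    ultimately show "Q ((p ^^ m) a, (q ^^ m) b) \<in> {None, Some ((id ^^ m) t)}"
      using eq_iff t by (metis id_apply id_funpow insert_iff option.discI)
  qed
  moreover have "rule3 l l (p, q, id) Q c s"
    unfolding rule3_def ij prod.case
  proof (intro allI impI ballI)
    fix m d
    assume d: "d \<in> cells l l" "Q d \<noteq> None \<and> collinear d ((p ^^ m) i, (q ^^ m) j)"
    have diag_m: "same_diagonal c ((p ^^ m) i, (q ^^ m) j)" by (auto simp: same_diagonal_def ij)
    show "Q d \<noteq> Some ((id ^^ m) s)"
    proof
      assume "Q d = Some ((id ^^ m) s)"
      then have "same_diagonal d c" using eq_iff[of d c] Q(2) c(1) d by auto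
      then have "same_diagonal d ((p ^^ m) i, (q ^^ m) j)"
        using diag_m by (rule same_diagonal_trans)
      then show False using same_diagonal_not_collinear d by blast
    qed
  qed
  ultimately show ?L using c by (simp add: legal_move_def Q_def)
qed

text \<open>If the diagonal of \<open>c = (i, j)\<close> is uncoloured, sending each column \<open>b \<noteq> j\<close> to the colour
  of the diagonal through \<open>(i, b)\<close> reaches every colour in use, so at most \<open>l - 1\<close> are: the diagonals through the cells of row \<open>i\<close> are all
  the diagonals, and the one through \<open>(i, j)\<close> is uncoloured.\<close>

lemma diagonal_colouring_extend:
  assumes diag: "diagonal_colouring P" and range: "ran P \<subseteq> {1..n'}" and "l \<le> n'"
    and c: "c \<in> cells l l" "P c = None"
  shows "\<exists>s\<in>{1..n'}. diagonal_colouring (P(c \<mapsto> s))"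
proof (cases "\<exists>d\<in>cells l l. same_diagonal c d \<and> P d \<noteq> None")
  case True
  then obtain d s where d: "d \<in> cells l l" "same_diagonal c d" "P d = Some s" by blast
  have "P e = Some s \<longleftrightarrow> same_diagonal c e" if e: "e \<in> cells l l" "P e \<noteq> None" for e
  proof -
    have "P e = Some s \<longleftrightarrow> same_diagonal d e"
      using diag d e unfolding diagonal_colouring_def by force
    also have "\<dots> \<longleftrightarrow> same_diagonal c e"
      using d c same_diagonal_sym same_diagonal_trans by blast
    finally show ?thesis .
  qed
  then have "diagonal_colouring (P(c \<mapsto> s))"
    by (simp add: diagonal_colouring_upd_iff[OF diag c])
  moreover have "s \<in> {1..n'}" using d range by (auto intro: ranI)
  ultimately show ?thesis by blast
next
  case False
  obtain i j where ij: "c = (i, j)" "i \<in> {1..l}" "j \<in> {1..l}"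
    using c(1) by (auto simp: cells_def)
  define U where "U = {s. \<exists>d\<in>cells l l. P d = Some s}"
  define f where
    "f b = the (P (SOME d. d \<in> cells l l \<and> same_diagonal d (i, b) \<and> P d \<noteq> None))" for b
  have "U \<subseteq> f ` ({1..l} - {j})"
  proof
    fix s assume "s \<in> U"
    then obtain d where d: "d \<in> cells l l" "P d = Some s" by (auto simp: U_def)
    obtain b where b: "b \<in> {1..l}" "same_diagonal d (i, b)"
      using diagonal_meets_row[OF d(1) ij(2)] by blast
    have "b \<noteq> j" using False b d ij(1) same_diagonal_sym[OF d(1)] by blast
    define e where "e = (SOME d. d \<in> cells l l \<and> same_diagonal d (i, b) \<and> P d \<noteq> None)"
    have e: "e \<in> cells l l \<and> same_diagonal e (i, b) \<and> P e \<noteq> None"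
      unfolding e_def by (rule someI[of _ d]) (use d b in auto)
    have "same_diagonal d e"
      using b e same_diagonal_sym same_diagonal_trans by blast
    then have "P e = Some s" using diag d e unfolding diagonal_colouring_def by force
    then have "f b = s" by (simp add: f_def e_def)
    then show "s \<in> f ` ({1..l} - {j})" using b \<open>b \<noteq> j\<close> by blast
  qed
  then have "finite U" and "card U \<le> card ({1..l} - {j})"
    by (auto intro: surj_card_le finite_subset)
  note this(2)
  also have "card ({1..l} - {j}) < n'" using ij \<open>l \<le> n'\<close> by auto
  finally have "\<not> {1..n'} \<subseteq> U" using card_mono[OF \<open>finite U\<close>, of "{1..n'}"] by auto
  then obtain s where s: "s \<in> {1..n'}" "s \<notin> U" by blast
  have "diagonal_colouring (P(c \<mapsto> s))"
    using s False by (auto simp: diagonal_colouring_upd_iff[OF diag c] U_def)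
  then show ?thesis using s by blast
qed

section \<open>Every play fills the board\<close>

lemma legal_play_diagonal_colouring:
  assumes "legal_play l l n' (p, q, id) ms"
  shows "diagonal_colouring (board ms) \<and> ran (board ms) \<subseteq> {1..n'}"
  using assms
proof (induction ms rule: rev_induct)
  case Nil
  show ?case by (simp add: board_def diagonal_colouring_def)
next
  case (snoc mv ms)
  obtain c s where mv: "mv = (c, s)" by fastforce
  have play: "legal_play l l n' (p, q, id) ms"
    unfolding legal_play_def
  proof (intro allI impI)
    fix k assume "k < length ms"
    then show "legal_move l l n' (p, q, id) (board (take k ms)) (ms ! k)"
      using snoc.prems[unfolded legal_play_def, rule_format, of k] by (simp add: nth_append)
  qed
  have "legal_move l l n' (p, q, id) (board ms) (c, s)"
    using snoc.prems[unfolded legal_play_def, rule_format, of "length ms"] mv by simp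
  then have "board ms c = None" "s \<in> {1..n'}" "diagonal_colouring ((board ms)(c \<mapsto> s))"
    using snoc.IH[OF play] legal_move_iff by auto
  moreover have "board (ms @ [mv]) = (board ms)(c \<mapsto> s)" by (simp add: board_def mv)
  ultimately show ?case using snoc.IH[OF play] by (metis insert_subset ran_map_upd)
qed

lemma finished_imp_full_board:
  assumes "legal_play l l n' (p, q, id) ms" "l \<le> n'" "finished l l n' (p, q, id) ms"
    and "c \<in> cells l l"
  shows "board ms c \<noteq> None"
proof
  assume "board ms c = None"
  moreover have inv: "diagonal_colouring (board ms)" "ran (board ms) \<subseteq> {1..n'}"
    using legal_play_diagonal_colouring[OF assms(1)] by auto
  ultimately obtain s where "s \<in> {1..n'}" "diagonal_colouring ((board ms)(c \<mapsto> s))"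
    using diagonal_colouring_extend assms by blast
  then have "legal_move l l n' (p, q, id) (board ms) (c, s)"
    using \<open>board ms c = None\<close> assms(4) inv legal_move_iff by simp
  then show False using assms(3) unfolding finished_def by blast
qed

lemma arbitrary_strategy_wins:
  assumes "l \<le> n'"
  shows "alice_winning_strategy first l l n' (p, q, id)
    (\<lambda>ms. SOME mv. legal_move l l n' (p, q, id) (board ms) mv)"
  unfolding alice_winning_strategy_def
  using assms finished_imp_full_board by (auto simp: finished_def intro: someI)

end

section \<open>Reading the cycle structure\<close>

lemma mem_cycle_structure_if_orbit:
  assumes "p permutes {1..m}" "i \<in> {1..m}"
  shows "card (orbit p i) \<in># cycle_structure m p"
proof -
  define k where "k = card (orbit p i)"
  have "orbit p i \<subseteq> {1..m}" using assms by (rule permutes_orbit_subset)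
  then have "k \<le> m" "finite (orbit p i)"
    using card_mono[of "{1..m}"] by (auto simp: k_def intro: finite_subset)
  then have "k \<in> {1..m}" using orbit_nonempty[of p i] by (auto simp: k_def Suc_le_eq card_gt_0_iff)
  moreover have "num_cycles m p k > 0"
    using assms(2) by (auto simp: num_cycles_def k_def card_gt_0_iff)
  ultimately show ?thesis
    by (auto simp: cycle_structure_def set_mset_sum k_def)
qed

lemma count_cycle_structure:
  "count (cycle_structure m p) k = (if k \<in> {1..m} then num_cycles m p k else 0)"
proof -
  have "count (cycle_structure m p) k = (\<Sum>j\<in>{1..m}. if k = j then num_cycles m p j else 0)"
    unfolding cycle_structure_def count_sum by (intro sum.cong) auto
  also have "\<dots> = (if k \<in> {1..m} then num_cycles m p k else 0)"
    by (rule sum.delta') simp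
  finally show ?thesis .
qed

text \<open>Every orbit length occurs in the multiset, so all orbits have length \<open>l\<close>; the
  multiplicity \<open>1\<close> leaves a single orbit, which must be all of \<open>{1..m}\<close>.\<close>

lemma cycle_structure_single:
  assumes "p permutes {1..m}" "m > 0" "cycle_structure m p = {#l#}"
  shows "m = l" and "cyclic_on p {1..l}"
proof -
  have len: "card (orbit p i) = l" if "i \<in> {1..m}" for i
    using mem_cycle_structure_if_orbit[OF assms(1) that] assms(3) by simp
  then have "{C \<in> orbit p ` {1..m}. card C = l} = orbit p ` {1..m}" by auto
  moreover have "num_cycles m p l = 1"
    using count_cycle_structure[of m p l] assms(3) by (simp split: if_splits)
  ultimately have "card (orbit p ` {1..m}) = 1" by (simp add: num_cycles_def)
  then obtain C where C: "orbit p ` {1..m} = {C}" by (auto simp: card_1_singleton_iff)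
  have one: "1 \<in> {1..m}" using assms(2) by simp
  have C1: "C = orbit p 1" using C one by blast
  have "{1..m} \<subseteq> C"
  proof
    fix i assume "i \<in> {1..m}"
    then have "orbit p i = C" using C by blast
    moreover have "permutation p" using assms(1) by (auto simp: permutation_permutes)
    ultimately show "i \<in> C" using permutation_self_in_orbit by metis
  qed
  moreover have "C \<subseteq> {1..m}" using C1 permutes_orbit_subset[OF assms(1) one] by simp
  ultimately have eq: "{1..m} = orbit p 1" using C1 by simp
  then show "m = l" using len[OF one] by (metis card_atLeastAtMost diff_Suc_1)
  then show "cyclic_on p {1..l}" using eq one cyclic_on_singleI by metis
qed

lemma cycle_structure_ones:
  assumes "p permutes {1..m}" "l > 0" "cycle_structure m p = replicate_mset l 1"
  shows "m = l" and "p = id"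
proof -
  have fixed: "p i = i" for i
  proof (cases "i \<in> {1..m}")
    case True
    then have "card (orbit p i) = 1"
      using mem_cycle_structure_if_orbit[OF assms(1) True] assms(3) by (simp split: if_splits)
    moreover have "permutation p" using assms(1) by (auto simp: permutation_permutes)
    then have "i \<in> orbit p i" by (rule permutation_self_in_orbit)
    ultimately have "orbit p i = {i}" by (metis card_1_singletonE singletonD)
    then show ?thesis by (simp add: orbit_eq_singleton_iff)
  next
    case False
    then show ?thesis using assms(1) by (simp add: permutes_def)
  qed
  then show "p = id" by auto
  have orb: "orbit p i = {i}" for i using fixed by (simp add: orbit_eq_singleton_iff)
  have "num_cycles m p 1 = l"
    using count_cycle_structure[of m p 1] assms(2,3) by (simp split: if_splits)
  moreover have "{C \<in> orbit p ` {1..m}. card C = 1} = (\<lambda>i. {i}) ` {1..m}"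
    using orb by auto
  ultimately show "m = l" by (simp add: num_cycles_def card_image)
qed

section \<open>The chromatic number\<close>

theorem theorem25:
  fixes n1 n2 n l :: nat and \<Theta> :: isotopism and first :: player
  assumes "n1 > 0" and "n2 > 0" and "n > 0" and "l > 0"
    and "\<Theta> \<in> isotopisms n1 n2 n"
    and "extendable n1 n2 n \<Theta>"
    and "isotopism_cycle_structure n1 n2 n \<Theta> = ({#l#}, {#l#}, replicate_mset l 1)"
  shows "stabilized_game_chromatic_number first n1 n2 n \<Theta> = enat l"
proof -
  obtain p q r where \<Theta>: "\<Theta> = (p, q, r)" by (cases \<Theta>) auto
  have perm: "p permutes {1..n1}" "q permutes {1..n2}" "r permutes {1..n}"
    using assms(5) by (auto simp: \<Theta> isotopisms_def)
  have struct: "cycle_structure n1 p = {#l#}" "cycle_structure n2 q = {#l#}"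
      "cycle_structure n r = replicate_mset l 1"
    using assms(7) by (auto simp: \<Theta> isotopism_cycle_structure_def)
  note p = cycle_structure_single[OF perm(1) assms(1) struct(1)]
  note q = cycle_structure_single[OF perm(2) assms(2) struct(2)]
  note r = cycle_structure_ones[OF perm(3) assms(4) struct(3)]
  interpret two_full_cycles p q l by unfold_locales (fact p(2), fact q(2))
  have ext: "natural_extension n \<Theta> = (p, q, id)"
    by (auto simp: natural_extension_def \<Theta> r(2))
  have "\<exists>\<sigma>. alice_winning_strategy first n1 n2 l (natural_extension n \<Theta>) \<sigma>"
    using arbitrary_strategy_wins[of l first] unfolding ext p(1) q(1) by blast
  then have "enat l \<in> {enat n' | n'. n' \<ge> n \<and>
      (\<exists>\<sigma>. alice_winning_strategy first n1 n2 n' (natural_extension n \<Theta>) \<sigma>)}"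
    using r(1) by blast
  then show ?thesis
    unfolding stabilized_game_chromatic_number_def
    by (intro antisym Inf_lower Inf_greatest) (auto simp: r(1))
qed

end
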